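(* Let $(M_n)_{n\ge1}$, $M_n=(f_n(m,k))_{1\le m,k\le 2n}$, be the Delta sequence. Then, as formal power series in $x,y,z$, $$\sum_{n\ge1}\ \sum_{2\le k+1\le m\le 2n} f_n(m,k)\,\frac{x^{m-k-1}}{(m-k-1)!}\,\frac{y^{k-1}}{(k-1)!}\,\frac{z^{2n-m}}{(2n-m)!} =\frac{\cos(\sqrt2\,x)+\cos(\sqrt2\,y)\cos(\sqrt2\,z)}{2\cos^2\!\big(\frac{x+y+z}{\sqrt2}\big)}.$$
   Context: Delta sequence. For $n\ge1$, $M_n=(f_n(m,k))_{1\le m,k\le 2n}$ is a $2n\times 2n$ matrix; by convention $f_n(m,k)=0$ if $(m,k)\notin[1,2n]^2$. Write $f_n(m,\bullet)=\sum_{k=1}^{2n}f_n(m,k)$ and $f_n(\bullet,k)=\sum_{m=1}^{2n}f_n(m,k)$. Let $L_n^{(1)}=\{(m,k):2\le k+1\le m\le 2n-2\}$ and $U_n^{(1)}=\{(m,k):2\le m+1\le k\le 2n-2\}$. The Delta sequence is the unique sequence $(M_n)_{n\ge1}$ of matrices with nonnegative integer entries such that $M_1=\begin{pmatrix}0&0\\1&0\end{pmatrix}$ and, for every $n\ge2$: (a) $f_n(m,m)=0$ for all $m$; (b) $f_n(m+2,k)-2f_n(m+1,k)+f_n(m,k)+2f_{n-1}(m,k)=0$ for $(m,k)\in L_n^{(1)}$; (c) $f_n(m,k+2)-2f_n(m,k+1)+f_n(m,k)+2f_{n-1}(m,k)=0$ for $(m,k)\in U_n^{(1)}$; (d) column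 $2n$ of $M_n$ is zero, and column $2n-1$ is $(f_{n-1}(1,\bullet),\dots,f_{n-1}(2n-2,\bullet),0,0)$ read top to bottom; (e) row $2n$ of $M_n$ is $(f_{n-1}(1,\bullet),\dots,f_{n-1}(2n-2,\bullet),0,0)$ read left to right, and row $2n-1$ is $(f_{n-1}(1,\bullet)+f_{n-1}(\bullet,1),\dots,f_{n-1}(2n-2,\bullet)+f_{n-1}(\bullet,2n-2),0,0)$. (These conditions determine the sequence uniquely.) *)

theory Defs
  imports "HOL-Computational_Algebra.Formal_Power_Series"
begin

unbundle fps_syntax

text \<open>
  A matrix sequence is a function \<open>f\<close> with \<open>f n m k\<close> the entry in row \<open>m\<close>, column \<open>k\<close> of the
  \<open>n\<close>-th matrix, all three indices starting at 1; the values at \<open>n = 0\<close> play no role.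
\<close>

definition row_sum :: "(nat \<Rightarrow> nat \<Rightarrow> nat \<Rightarrow> nat) \<Rightarrow> nat \<Rightarrow> nat \<Rightarrow> nat" where
  "row_sum f n m = (\<Sum>k = 1..2 * n. f n m k)"

definition col_sum :: "(nat \<Rightarrow> nat \<Rightarrow> nat \<Rightarrow> nat) \<Rightarrow> nat \<Rightarrow> nat \<Rightarrow> nat" where
  "col_sum f n k = (\<Sum>m = 1..2 * n. f n m k)"

definition L1 :: "nat \<Rightarrow> (nat \<times> nat) set" where
  "L1 n = {(m, k). 2 \<le> k + 1 \<and> k + 1 \<le> m \<and> m \<le> 2 * n - 2}"

definition U1 :: "nat \<Rightarrow> (nat \<times> nat) set" where
  "U1 n = {(m, k). 2 \<le> m + 1 \<and> m + 1 \<le> k \<and> k \<le> 2 * n - 2}"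

definition delta_sequence :: "(nat \<Rightarrow> nat \<Rightarrow> nat \<Rightarrow> nat) \<Rightarrow> bool" where
  "delta_sequence f \<longleftrightarrow>
    (\<forall>n\<ge>1. \<forall>m k. (m, k) \<notin> {1..2 * n} \<times> {1..2 * n} \<longrightarrow> f n m k = 0) \<and>
    f 1 1 1 = 0 \<and> f 1 1 2 = 0 \<and> f 1 2 1 = 1 \<and> f 1 2 2 = 0 \<and>
    (\<forall>n\<ge>2.
      (\<forall>m\<in>{1..2 * n}. f n m m = 0) \<and>
      (\<forall>(m, k)\<in>L1 n.
        int (f n (m + 2) k) - 2 * int (f n (m + 1) k) + int (f n m k) + 2 * int (f (n - 1) m k) = 0) \<and>
      (\<forall>(m, k)\<in>U1 n.
        int (f n m (k + 2)) - 2 * int (f n m (k + 1)) + int (f n m k) + 2 * int (f (n - 1) m k) = 0) \<and>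
      (\<forall>m\<in>{1..2 * n}. f n m (2 * n) = 0) \<and>
      (\<forall>m\<in>{1..2 * n - 2}. f n m (2 * n - 1) = row_sum f (n - 1) m) \<and>
      f n (2 * n - 1) (2 * n - 1) = 0 \<and> f n (2 * n) (2 * n - 1) = 0 \<and>
      (\<forall>k\<in>{1..2 * n - 2}. f n (2 * n) k = row_sum f (n - 1) k) \<and>
      f n (2 * n) (2 * n - 1) = 0 \<and> f n (2 * n) (2 * n) = 0 \<and>
      (\<forall>k\<in>{1..2 * n - 2}. f n (2 * n - 1) k = row_sum f (n - 1) k + col_sum f (n - 1) k) \<and>
      f n (2 * n - 1) (2 * n - 1) = 0 \<and> f n (2 * n - 1) (2 * n) = 0)"

text \<open>
  Formal power series in \<open>x\<close>, \<open>y\<close>, \<open>z\<close> over the reals are iterated univariate series;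
  the coefficient of \<open>x\<^sup>a y\<^sup>b z\<^sup>c\<close> in \<open>S\<close> is \<open>S $ a $ b $ c\<close>.
\<close>

type_synonym fps3 = "real fps fps fps"

definition const3 :: "real \<Rightarrow> fps3" where
  "const3 r = fps_const (fps_const (fps_const r))"

definition X3 :: fps3 where "X3 = fps_X"
definition Y3 :: fps3 where "Y3 = fps_const fps_X"
definition Z3 :: fps3 where "Z3 = fps_const (fps_const fps_X)"

text \<open>
  Substitution \<open>F(w) = \<Sum>j. F $ j * w ^ j\<close> of a series \<open>w\<close> without constant term. As \<open>w ^ j\<close> has
  no monomials of total degree below \<open>j\<close>, each coefficient is a finite sum. The library's
  \<open>fps_compose\<close> does not apply: it needs the part of \<open>w\<close> free of the outermost variable to vanish,
  which fails for \<open>x + y + z\<close>.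
\<close>

definition compose3 :: "real fps \<Rightarrow> fps3 \<Rightarrow> fps3" where
  "compose3 F w =
    Abs_fps (\<lambda>a. Abs_fps (\<lambda>b. Abs_fps (\<lambda>c. \<Sum>j\<le>a + b + c. F $ j * (w ^ j) $ a $ b $ c)))"

definition cos3 :: "fps3 \<Rightarrow> fps3" where
  "cos3 w = compose3 (fps_cos 1) w"

text \<open>
  Formal infinite sums: each monomial receives only finitely many nonzero contributions. Convergence
  in the metric of the outermost \<open>fps\<close> would be too strong, as it ignores the degrees in \<open>y\<close>, \<open>z\<close>.
\<close>

definition has_sum3 :: "('i \<Rightarrow> fps3) \<Rightarrow> 'i set \<Rightarrow> fps3 \<Rightarrow> bool" where
  "has_sum3 g A S \<longleftrightarrow>
    (\<forall>a b c. finite {i \<in> A. g i $ a $ b $ c \<noteq> 0} \<and>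
      (\<Sum>i | i \<in> A \<and> g i $ a $ b $ c \<noteq> 0. g i $ a $ b $ c) = S $ a $ b $ c)"

text \<open>
  The library division on iterated series is the genuine quotient whenever the denominator has a
  nonzero constant term, as is the case for \<open>2 cos\<^sup>2((x + y + z) / \<surd>2)\<close>.
\<close>

lemma fps3_divide_mult:
  fixes N D :: fps3
  assumes "D $ 0 $ 0 $ 0 \<noteq> 0"
  shows "N / D * D = N"
proof -
  have 1: "D $ 0 $ 0 * inverse (D $ 0 $ 0) = 1"
    using assms by (intro inverse_mult_eq_1') simp_all
  have 2: "D $ 0 * inverse (D $ 0) = 1"
    by (rule fps_right_inverse[OF 1, folded fps_inverse_def])
  have 3: "D * inverse D = 1"
    by (rule fps_right_inverse[OF 2, folded fps_inverse_def])
  have "D $ 0 \<noteq> 0" using assms by auto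
  then have "subdegree D = 0" by (simp add: subdegree_eq_0)
  then have "N / D = N * inverse D" by (simp add: fps_divide_def)
  then show ?thesis using 3 by (simp add: mult.assoc mult.commute)
qed

lemma cos3_denominator_nth_0:
  "(2 * (cos3 (const3 (1 / sqrt 2) * (X3 + Y3 + Z3)))\<^sup>2) $ 0 $ 0 $ 0 = 2"
  by (simp add: cos3_def compose3_def fps_cos_def power2_eq_square fps_mult_nth
      fps_numeral_fps_const)

end

theory Submission
  imports Defs
begin

text \<open>
  Let \<open>G\<close> and \<open>H\<close> be the exponential generating functions of the entries below and above the
  diagonal. The recurrences (b), (c) say \<open>(\<partial>\<^sub>x - \<partial>\<^sub>z)\<^sup>2 F = -2 F\<close> for both, and (d), (e) prescribe the
  values and the \<open>z\<close>-derivatives at \<open>z = 0\<close> in terms of row and column sums of smaller degree; these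
  data determine \<open>G\<close> and \<open>H\<close>. They are solved by the stated \<open>G\<close> together with
  \<open>H = sin(\<surd>2 y) sin(\<surd>2 z) / (2 cos\<^sup>2((x + y + z) / \<surd>2))\<close>: differences of partial derivatives
  annihilate the common denominator, so the row and column sums telescope to
  \<open>sin(\<surd>2 u) / (\<surd>2 cos\<^sup>2((u + v) / \<surd>2))\<close> and its mirror image.
\<close>

section \<open>Constant series\<close>

lemma const3_nth: "const3 r $ a $ b $ c = (if a = 0 \<and> b = 0 \<and> c = 0 then r else 0)"
  by (simp add: const3_def)

lemma const3_mult_nth [simp]: "(const3 r * F) $ a $ b $ c = r * F $ a $ b $ c"
  by (simp add: const3_def)

lemma const3_mult: "const3 (r * s) = const3 r * const3 s"
  and const3_0: "const3 0 = 0"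
  and const3_1: "const3 1 = 1"
  by (simp_all add: const3_def)

lemma const3_numeral: "const3 (numeral n) = numeral n"
  by (simp add: const3_def fps_numeral_fps_const)

lemma fps3_eqI: "(\<And>a b c. F $ a $ b $ c = G $ a $ b $ c) \<Longrightarrow> F = (G :: fps3)"
  by (simp add: fps_eq_iff)

section \<open>Partial derivatives of trivariate series\<close>

definition sin3 :: "fps3 \<Rightarrow> fps3" where
  "sin3 w = compose3 (fps_sin 1) w"

definition dX :: "fps3 \<Rightarrow> fps3" where "dX F = fps_deriv F"
definition dY :: "fps3 \<Rightarrow> fps3" where "dY F = Abs_fps (\<lambda>a. fps_deriv (F $ a))"
definition dZ :: "fps3 \<Rightarrow> fps3" where "dZ F = Abs_fps (\<lambda>a. Abs_fps (\<lambda>b. fps_deriv (F $ a $ b)))"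

lemma of_nat_fps_mult_nth: "(of_nat n * (F :: 'a :: comm_ring_1 fps)) $ a = of_nat n * F $ a"
  by (simp flip: fps_of_nat)

lemma dX_nth: "dX F $ a $ b $ c = real (Suc a) * F $ Suc a $ b $ c"
  by (simp add: dX_def of_nat_fps_mult_nth algebra_simps)

lemma dY_nth: "dY F $ a $ b $ c = real (Suc b) * F $ a $ Suc b $ c"
  by (simp add: dY_def of_nat_fps_mult_nth algebra_simps)

lemma dZ_nth: "dZ F $ a $ b $ c = real (Suc c) * F $ a $ b $ Suc c"
  by (simp add: dZ_def)

lemma dX_mult: "dX (F * G) = dX F * G + F * dX G"
  by (simp add: dX_def)

lemma dY_mult: "dY (F * G) = dY F * G + F * dY G"
  by (rule fps_ext) (simp add: dY_def fps_mult_nth fps_deriv_sum sum.distrib)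

lemma dZ_mult: "dZ (F * G) = dZ F * G + F * dZ G"
proof (rule fps_ext, rule fps_ext)
  fix a b
  show "dZ (F * G) $ a $ b = (dZ F * G + F * dZ G) $ a $ b"
    by (simp add: dZ_def fps_mult_nth fps_deriv_sum fps_sum_nth sum.distrib)
qed

text \<open>Each coefficient of \<open>d F\<close> is a multiple of one coefficient of
  \<open>F\<close> of total degree one higher. This and the product rule are what the chain rule
  needs, so it is proved once for all three variables.\<close>

locale partial_derivative =
  fixes d :: "fps3 \<Rightarrow> fps3"
  assumes leibniz: "d (F * G) = d F * G + F * d G"
    and shift: "\<exists>k a' b' c'. a' + b' + c' = Suc (a + b + c) \<and> (\<forall>F. d F $ a $ b $ c = k * F $ a' $ b' $ c')"
begin

lemma add: "d (F + G) = d F + d G"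
proof (rule fps3_eqI)
  fix a b c
  show "d (F + G) $ a $ b $ c = (d F + d G) $ a $ b $ c"
    using shift[of a b c] by (auto simp: distrib_left)
qed

lemma diff: "d (F - G) = d F - d G"
proof (rule fps3_eqI)
  fix a b c
  show "d (F - G) $ a $ b $ c = (d F - d G) $ a $ b $ c"
    using shift[of a b c] by (auto simp: right_diff_distrib)
qed

lemma minus: "d (- F) = - d F"
proof (rule fps3_eqI)
  fix a b c
  show "d (- F) $ a $ b $ c = (- d F) $ a $ b $ c"
    using shift[of a b c] by auto
qed

lemma const: "d (const3 r) = 0"
proof (rule fps3_eqI)
  fix a b c
  show "d (const3 r) $ a $ b $ c = 0 $ a $ b $ c"
    using shift[of a b c] by (auto simp: const3_nth)
qed

lemma numeral: "d (numeral n) = 0"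
  using const[of "numeral n"] by (simp add: const3_numeral)

lemma one: "d 1 = 0"
  using const[of 1] by (simp add: const3_1)

lemma power_Suc: "d (w ^ Suc j) = of_nat (Suc j) * w ^ j * d w"
  by (induction j) (simp_all add: leibniz algebra_simps)

text \<open>The chain rule for an inner series with constant derivative \<open>p\<close>, reduced to
  the power rule coefficient by coefficient.\<close>

lemma compose:
  assumes w: "d w = const3 p"
  shows "d (compose3 F w) = const3 p * compose3 (fps_deriv F) w"
proof (rule fps3_eqI)
  fix a b c
  obtain k a' b' c' where s: "a' + b' + c' = Suc (a + b + c)"
    and d: "\<And>F. d F $ a $ b $ c = k * F $ a' $ b' $ c'"
    using shift[of a b c] by auto
  have pw: "k * (w ^ Suc j) $ a' $ b' $ c' = real (Suc j) * p * (w ^ j) $ a $ b $ c" for j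
    unfolding d[symmetric] power_Suc w
    by (simp add: mult.assoc mult.commute[of _ "const3 p"] of_nat_fps_mult_nth del: of_nat_Suc)
  have p0: "k * (w ^ 0) $ a' $ b' $ c' = 0"
    unfolding d[symmetric] by (simp add: one)
  have "d (compose3 F w) $ a $ b $ c = (\<Sum>j\<le>Suc (a + b + c). F $ j * (k * (w ^ j) $ a' $ b' $ c'))"
    unfolding d by (simp add: compose3_def s sum_distrib_left mult_ac del: sum.atMost_Suc)
  \<comment> \<open>The term \<open>j = 0\<close> vanishes, and reindexing by \<open>Suc j\<close>
    turns the truncation at degree \<open>Suc (a + b + c)\<close> into the one at
    \<open>a + b + c\<close>.\<close>
  also have "\<dots> = (\<Sum>j\<le>a + b + c. F $ Suc j * (real (Suc j) * p * (w ^ j) $ a $ b $ c))"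
    unfolding sum.atMost_Suc_shift pw p0 by simp
  also have "\<dots> = (const3 p * compose3 (fps_deriv F) w) $ a $ b $ c"
    by (simp add: compose3_def sum_distrib_left algebra_simps)
  finally show "d (compose3 F w) $ a $ b $ c = (const3 p * compose3 (fps_deriv F) w) $ a $ b $ c" .
qed

lemma cos3: "d w = const3 p \<Longrightarrow> d (cos3 w) = - (const3 p * sin3 w)"
  unfolding cos3_def sin3_def
  by (subst compose, assumption) (simp add: fps_eq_iff fps_cos_deriv compose3_def sum_negf)

lemma sin3: "d w = const3 p \<Longrightarrow> d (sin3 w) = const3 p * cos3 w"
  unfolding cos3_def sin3_def
  by (subst compose, assumption) (simp add: fps_sin_deriv)

end

interpretation dX: partial_derivative dX
proof
  show "\<exists>k a' b' c'. a' + b' + c' = Suc (a + b + c) \<and> (\<forall>F. dX F $ a $ b $ c = k * F $ a' $ b' $ c')"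
    for a b c by (rule exI[of _ "real (Suc a)"], rule exI[of _ "Suc a"], rule exI[of _ b], rule exI[of _ c])
      (simp only: dX_nth, simp)
qed (rule dX_mult)

interpretation dY: partial_derivative dY
proof
  show "\<exists>k a' b' c'. a' + b' + c' = Suc (a + b + c) \<and> (\<forall>F. dY F $ a $ b $ c = k * F $ a' $ b' $ c')"
    for a b c by (rule exI[of _ "real (Suc b)"], rule exI[of _ a], rule exI[of _ "Suc b"], rule exI[of _ c])
      (simp only: dY_nth, simp)
qed (rule dY_mult)

interpretation dZ: partial_derivative dZ
proof
  show "\<exists>k a' b' c'. a' + b' + c' = Suc (a + b + c) \<and> (\<forall>F. dZ F $ a $ b $ c = k * F $ a' $ b' $ c')"
    for a b c by (rule exI[of _ "real (Suc c)"], rule exI[of _ a], rule exI[of _ b], rule exI[of _ "Suc c"])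
      (simp only: dZ_nth, simp)
qed (rule dZ_mult)

text \<open>The factors \<open>Suc i\<close> in the derivative coefficients are nonzero reals.
  Trigonometric identities thereby reduce to vanishing derivatives and a comparison of constant
  terms.\<close>

lemma fps3_eq_const:
  assumes "dX F = 0" "dY F = 0" "dZ F = 0"
  shows "F = const3 (F $ 0 $ 0 $ 0)"
proof (rule fps3_eqI)
  fix a b c
  have "F $ Suc i $ j $ k = 0" "F $ i $ Suc j $ k = 0" "F $ i $ j $ Suc k = 0" for i j k
    using dX_nth[of F i j k] dY_nth[of F i j k] dZ_nth[of F i j k] assms by simp_all
  then show "F $ a $ b $ c = const3 (F $ 0 $ 0 $ 0) $ a $ b $ c"
    by (cases a; cases b; cases c) (simp_all add: const3_nth)
qed

lemma coordinate_derivs: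
  "dX X3 = const3 1" "dX Y3 = const3 0" "dX Z3 = const3 0"
  "dY X3 = const3 0" "dY Y3 = const3 1" "dY Z3 = const3 0"
  "dZ X3 = const3 0" "dZ Y3 = const3 0" "dZ Z3 = const3 1"
  by (simp_all add: X3_def Y3_def Z3_def const3_0 const3_1 dX_def dY_def dZ_def fps_eq_iff)

lemma cos3_nth_0 [simp]: "cos3 w $ 0 $ 0 $ 0 = 1"
  and sin3_nth_0 [simp]: "sin3 w $ 0 $ 0 $ 0 = 0"
  by (simp_all add: cos3_def sin3_def compose3_def)

section \<open>The closed forms\<close>

definition cX :: fps3 where "cX = cos3 (const3 (sqrt 2) * X3)"
definition sX :: fps3 where "sX = sin3 (const3 (sqrt 2) * X3)"
definition cY :: fps3 where "cY = cos3 (const3 (sqrt 2) * Y3)"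
definition sY :: fps3 where "sY = sin3 (const3 (sqrt 2) * Y3)"
definition cZ :: fps3 where "cZ = cos3 (const3 (sqrt 2) * Z3)"
definition sZ :: fps3 where "sZ = sin3 (const3 (sqrt 2) * Z3)"
text \<open>With \<open>sqrt 2\<close> written as \<open>2 * hs\<close> and the relation
  \<open>hs_square\<close>, identities involving these constants become polynomial
  identities.\<close>

definition hs :: fps3 where "hs = const3 (1 / sqrt 2)"
definition cW :: fps3 where "cW = cos3 (const3 (1 / sqrt 2) * (X3 + Y3 + Z3))"
definition sW :: fps3 where "sW = sin3 (const3 (1 / sqrt 2) * (X3 + Y3 + Z3))"

lemma const3_sqrt_2: "const3 (sqrt 2) = 2 * hs"
proof -
  have "sqrt 2 = 2 * (1 / sqrt 2)"
    by (simp add: field_simps)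
  then show ?thesis
    unfolding hs_def by (metis const3_mult const3_numeral)
qed

lemma hs_square: "2 * hs * hs = 1"
proof -
  have "2 * (1 / sqrt 2) * (1 / sqrt 2) = (1 :: real)"
    by (simp add: field_simps)
  then show ?thesis
    unfolding hs_def by (metis const3_mult const3_numeral const3_1)
qed

lemma scaled_coordinate_derivs:
  "dX (const3 r * X3) = const3 r" "dX (const3 r * Y3) = const3 0" "dX (const3 r * Z3) = const3 0"
  "dX (const3 r * (X3 + Y3 + Z3)) = const3 r"
  "dY (const3 r * X3) = const3 0" "dY (const3 r * Y3) = const3 r" "dY (const3 r * Z3) = const3 0"
  "dY (const3 r * (X3 + Y3 + Z3)) = const3 r"
  "dZ (const3 r * X3) = const3 0" "dZ (const3 r * Y3) = const3 0" "dZ (const3 r * Z3) = const3 r"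
  "dZ (const3 r * (X3 + Y3 + Z3)) = const3 r"
  by (simp_all add: dX.leibniz dY.leibniz dZ.leibniz dX.const dY.const dZ.const
      dX.add dY.add dZ.add coordinate_derivs const3_0 const3_1)

lemma trig_derivs:
  "dX cX = - (2 * hs * sX)" "dX sX = 2 * hs * cX" "dX cY = 0" "dX sY = 0" "dX cZ = 0" "dX sZ = 0"
  "dY cY = - (2 * hs * sY)" "dY sY = 2 * hs * cY" "dY cX = 0" "dY sX = 0" "dY cZ = 0" "dY sZ = 0"
  "dZ cZ = - (2 * hs * sZ)" "dZ sZ = 2 * hs * cZ" "dZ cX = 0" "dZ sX = 0" "dZ cY = 0" "dZ sY = 0"
  "dX cW = - (hs * sW)" "dX sW = hs * cW"
  "dY cW = - (hs * sW)" "dY sW = hs * cW"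
  "dZ cW = - (hs * sW)" "dZ sW = hs * cW"
  unfolding cX_def sX_def cY_def sY_def cZ_def sZ_def cW_def sW_def
    scaled_coordinate_derivs(1-4)[THEN dX.cos3] scaled_coordinate_derivs(1-4)[THEN dX.sin3]
    scaled_coordinate_derivs(5-8)[THEN dY.cos3] scaled_coordinate_derivs(5-8)[THEN dY.sin3]
    scaled_coordinate_derivs(9-12)[THEN dZ.cos3] scaled_coordinate_derivs(9-12)[THEN dZ.sin3]
  by (simp_all add: const3_sqrt_2 const3_0 flip: hs_def)

lemmas deriv_rules = trig_derivs
  dX.leibniz dY.leibniz dZ.leibniz dX.add dY.add dZ.add dX.diff dY.diff dZ.diff
  dX.minus dY.minus dZ.minus
  dX.numeral dY.numeral dZ.numeral dX.one dY.one dZ.one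
  dX.const[of "1 / sqrt 2", folded hs_def] dY.const[of "1 / sqrt 2", folded hs_def]
  dZ.const[of "1 / sqrt 2", folded hs_def]

lemma trig_nth_0 [simp]:
  "cX $ 0 $ 0 $ 0 = 1" "cY $ 0 $ 0 $ 0 = 1" "cZ $ 0 $ 0 $ 0 = 1" "cW $ 0 $ 0 $ 0 = 1"
  "sX $ 0 $ 0 $ 0 = 0" "sY $ 0 $ 0 $ 0 = 0" "sZ $ 0 $ 0 $ 0 = 0" "sW $ 0 $ 0 $ 0 = 0"
  by (simp_all add: cX_def sX_def cY_def sY_def cZ_def sZ_def cW_def sW_def)

lemma pythagoras:
  "cX * cX + sX * sX = 1" "cW * cW + sW * sW = 1"
  using fps3_eq_const[of "cX * cX + sX * sX"] fps3_eq_const[of "cW * cW + sW * sW"]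
  by (simp_all add: deriv_rules const3_1)

text \<open>
  With \<open>w = (x + y + z) / \<surd>2\<close>, the two angles \<open>w - \<surd>2 x\<close> and \<open>w - \<surd>2 (y + z)\<close> are opposite, so
  their sines add up to zero. The two combinations of products below, the sine and cosine of
  the sum of these angles, have vanishing partial derivatives.
\<close>
lemma sum_to_product:
  "sW * (cX + (cY * cZ - sY * sZ)) = cW * (sX + (sY * cZ + cY * sZ))"
proof -
  define A where "A = sW * cX - cW * sX"
  define B where "B = cW * cX + sW * sX"
  define A' where "A' = sW * (cY * cZ - sY * sZ) - cW * (sY * cZ + cY * sZ)"
  define B' where "B' = cW * (cY * cZ - sY * sZ) + sW * (sY * cZ + cY * sZ)"
  have dA: "dX A = - (hs * B)" "dY A = hs * B" "dZ A = hs * B"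
    and dB: "dX B = hs * A" "dY B = - (hs * A)" "dZ B = - (hs * A)"
    and dA': "dX A' = hs * B'" "dY A' = - (hs * B')" "dZ A' = - (hs * B')"
    and dB': "dX B' = - (hs * A')" "dY B' = hs * A'" "dZ B' = hs * A'"
    unfolding A_def B_def A'_def B'_def by (simp_all add: deriv_rules) algebra+
  note rules = deriv_rules dA dB dA' dB'
  have nth_0: "A $ 0 $ 0 $ 0 = 0" "B $ 0 $ 0 $ 0 = 1" "A' $ 0 $ 0 $ 0 = 0" "B' $ 0 $ 0 $ 0 = 1"
    unfolding A_def B_def A'_def B'_def by simp_all
  have 1: "A * B' + B * A' = 0"
    using fps3_eq_const[of "A * B' + B * A'"] by (simp add: rules nth_0 const3_0)
  have 2: "B * B' - A * A' = 1"
    using fps3_eq_const[of "B * B' - A * A'"] by (simp add: rules nth_0 const3_1)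
  have 3: "A * A + B * B = 1"
    using pythagoras unfolding A_def B_def by algebra
  \<comment> \<open>Multiplying \<open>2\<close> by \<open>A\<close> and \<open>1\<close> by
    \<open>B\<close> and subtracting gives \<open>- (A * A + B * B) * A' = A\<close>.\<close>
  have "A + A' = 0"
    using 1 2 3 by algebra
  then show ?thesis
    unfolding A_def A'_def by algebra
qed

section \<open>The reciprocal denominator and the two generating functions\<close>

definition E3 :: fps3 where "E3 = 1 / (2 * cW\<^sup>2)"

lemma E3_mult: "2 * E3 * cW * cW = 1"
  using fps3_divide_mult[of "2 * cW\<^sup>2" 1] cos3_denominator_nth_0
  unfolding E3_def by (simp add: cW_def power2_eq_square mult_ac)

text \<open>Implicit differentiation of \<open>E3_mult\<close>; multiplying by \<open>2 * E3\<close>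
  then removes the factor \<open>cW * cW\<close>.\<close>

lemma E3_derivs:
  "dX E3 = 4 * hs * E3 * E3 * cW * sW"
  "dY E3 = 4 * hs * E3 * E3 * cW * sW"
  "dZ E3 = 4 * hs * E3 * E3 * cW * sW"
proof -
  have "dX (2 * E3 * cW * cW) = 0" "dY (2 * E3 * cW * cW) = 0" "dZ (2 * E3 * cW * cW) = 0"
    unfolding E3_mult by (simp_all add: deriv_rules)
  then have *: "dX E3 * cW * cW = 2 * hs * E3 * cW * sW" "dY E3 * cW * cW = 2 * hs * E3 * cW * sW"
    "dZ E3 * cW * cW = 2 * hs * E3 * cW * sW"
    by (simp_all add: deriv_rules) algebra+
  show "dX E3 = 4 * hs * E3 * E3 * cW * sW" "dY E3 = 4 * hs * E3 * E3 * cW * sW"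
    "dZ E3 = 4 * hs * E3 * E3 * cW * sW"
    using * E3_mult by algebra+
qed

definition GL :: fps3 where "GL = E3 * (cX + cY * cZ)"
definition GU :: fps3 where "GU = E3 * sY * sZ"

text \<open>\<open>dX - dZ\<close> annihilates \<open>E3\<close>, so it acts on the numerator alone,
  and its square multiplies both \<open>cX\<close> and \<open>cY * cZ\<close> by
  \<open>- 4 * hs * hs = - 1 - 1\<close>.\<close>

lemma GL_wave: "dX (dX GL - dZ GL) - dZ (dX GL - dZ GL) = - (2 * GL)"
proof -
  have "dX GL - dZ GL = 2 * hs * E3 * (cY * sZ - sX)"
    unfolding GL_def by (simp add: deriv_rules E3_derivs) algebra
  then show ?thesis
    using hs_square by (simp add: GL_def deriv_rules E3_derivs) algebra
qed

lemma GU_wave: "dX (dX GU - dZ GU) - dZ (dX GU - dZ GU) = - (2 * GU)"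
proof -
  have "dX GU - dZ GU = - (2 * hs * E3 * sY * cZ)"
    unfolding GU_def by (simp add: deriv_rules E3_derivs)
  then show ?thesis
    using hs_square by (simp add: GU_def deriv_rules E3_derivs) algebra
qed

text \<open>In the next four identities a factor \<open>sZ\<close> marks the part that vanishes at \<open>z = 0\<close>.\<close>
lemma dX_GL: "dX GL = 2 * hs * (E3 * sY * cZ) + (2 * hs * E3 * cY + 4 * hs * E3 * E3 * cW * sW * sY) * sZ"
proof -
  have "dX GL = 4 * hs * E3 * E3 * cW * sW * (cX + cY * cZ) - 2 * hs * E3 * sX"
    unfolding GL_def by (simp add: deriv_rules E3_derivs)
  \<comment> \<open>After \<open>sum_to_product\<close> rewrites \<open>sW * (cX + cY * cZ)\<close>,
    the factor \<open>2 * E3 * cW * cW\<close> becomes 1 and the \<open>sX\<close> terms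
    cancel.\<close>
  then show ?thesis
    using sum_to_product E3_mult by algebra
qed

lemma dZ_GL: "dZ GL = dX GL + 2 * hs * (E3 * sX) - 2 * hs * E3 * cY * sZ"
  unfolding GL_def by (simp add: deriv_rules E3_derivs)

lemma dY_GL: "dY GL = dX GL + 2 * hs * (E3 * sX) - 2 * hs * (E3 * sY * cZ)"
  unfolding GL_def by (simp add: deriv_rules E3_derivs)

lemma dZ_GU: "dZ GU = 2 * hs * (E3 * sY * cZ) + 4 * hs * E3 * E3 * cW * sW * sY * sZ"
  unfolding GU_def by (simp add: deriv_rules E3_derivs)

text \<open>
  An antiderivative for a difference of two partial derivatives makes a sum of exponential
  coefficients along a row or column telescope.
\<close>
lemma GL_antideriv_XY: "dX (hs * (E3 * sX - E3 * sY * cZ)) - dY (hs * (E3 * sX - E3 * sY * cZ)) = GL"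
  using hs_square unfolding GL_def by (simp add: deriv_rules E3_derivs) algebra

lemma GL_antideriv_XZ: "dX (hs * (E3 * sX - E3 * cY * sZ)) - dZ (hs * (E3 * sX - E3 * cY * sZ)) = GL"
  using hs_square unfolding GL_def by (simp add: deriv_rules E3_derivs) algebra

lemma GU_antideriv_XZ: "dX (hs * (E3 * sY * cZ)) - dZ (hs * (E3 * sY * cZ)) = GU"
  using hs_square unfolding GU_def by (simp add: deriv_rules E3_derivs) algebra

lemma GU_antideriv_XY: "dX (hs * (E3 * cY * sZ)) - dY (hs * (E3 * cY * sZ)) = GU"
  using hs_square unfolding GU_def by (simp add: deriv_rules E3_derivs) algebra

section \<open>Exponential coefficients\<close>

lemma X3_power_nth: "(X3 ^ j) $ a $ b $ c = (if a = j \<and> b = 0 \<and> c = 0 then 1 else 0)"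
  by (simp add: X3_def fps_X_power_nth)

lemma Y3_power_nth: "(Y3 ^ j) $ a $ b $ c = (if a = 0 \<and> b = j \<and> c = 0 then 1 else 0)"
proof -
  have "Y3 ^ j = fps_const (fps_X ^ j)"
    by (induction j) (simp_all add: Y3_def)
  then show ?thesis
    by (simp add: fps_X_power_nth)
qed

lemma Z3_power_nth: "(Z3 ^ j) $ a $ b $ c = (if a = 0 \<and> b = 0 \<and> c = j then 1 else 0)"
proof -
  have "Z3 ^ j = fps_const (fps_const (fps_X ^ j))"
    by (induction j) (simp_all add: Z3_def)
  then show ?thesis
    by (simp add: fps_X_power_nth)
qed

lemma const3_power: "const3 r ^ j = const3 (r ^ j)"
  by (induction j) (simp_all add: const3_1 const3_mult)

lemma compose3_X: "compose3 F (const3 r * X3) = Abs_fps (\<lambda>a. fps_const (fps_const (F $ a * r ^ a)))"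
  by (rule fps3_eqI)
    (simp add: compose3_def power_mult_distrib const3_power X3_power_nth if_distrib cong: if_cong)

lemma compose3_Y: "compose3 F (const3 r * Y3) = fps_const (Abs_fps (\<lambda>b. fps_const (F $ b * r ^ b)))"
  by (rule fps3_eqI)
    (simp add: compose3_def power_mult_distrib const3_power Y3_power_nth if_distrib cong: if_cong)

lemma compose3_Z: "compose3 F (const3 r * Z3) = fps_const (fps_const (Abs_fps (\<lambda>c. F $ c * r ^ c)))"
  by (rule fps3_eqI)
    (simp add: compose3_def power_mult_distrib const3_power Z3_power_nth if_distrib cong: if_cong)

text \<open>One coefficient sequence serves all three variables, so products with \<open>sX\<close>,
  \<open>sY\<close> and \<open>sZ\<close> can be compared after permuting indices.\<close>

definition sin_coeff2 :: "nat \<Rightarrow> real" where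
  "sin_coeff2 j = fps_sin 1 $ j * sqrt 2 ^ j"

lemma mult_sX_nth: "(F * sX) $ a $ b $ c = (\<Sum>i\<le>a. F $ i $ b $ c * sin_coeff2 (a - i))"
  unfolding sX_def sin3_def compose3_X fps_mult_nth[of F]
  by (simp add: fps_sum_nth atLeast0AtMost sin_coeff2_def)

lemma mult_sY_nth: "(F * sY) $ a $ b $ c = (\<Sum>i\<le>b. F $ a $ i $ c * sin_coeff2 (b - i))"
  unfolding sY_def sin3_def compose3_Y fps_mult_right_const_nth fps_mult_nth[of "F $ a"]
  by (simp add: fps_sum_nth atLeast0AtMost sin_coeff2_def)

lemma mult_sZ_nth: "(F * sZ) $ a $ b $ c = (\<Sum>i\<le>c. F $ a $ b $ i * sin_coeff2 (c - i))"
  unfolding sZ_def sin3_def compose3_Z fps_mult_right_const_nth fps_mult_nth[of "F $ a $ b"]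
  by (simp add: atLeast0AtMost sin_coeff2_def)

lemma sin_coeff2_0 [simp]: "sin_coeff2 0 = 0"
  by (simp add: sin_coeff2_def)

lemma mult_cY_nth_0: "(F * cY) $ a $ 0 $ c = F $ a $ 0 $ c"
  and mult_cZ_nth_0: "(F * cZ) $ a $ b $ 0 = F $ a $ b $ 0"
  by (simp_all add: cY_def cZ_def cos3_def compose3_Y compose3_Z)

text \<open>The factorials turn partial derivatives into plain index shifts.\<close>

definition egf_coeff :: "fps3 \<Rightarrow> nat \<Rightarrow> nat \<Rightarrow> nat \<Rightarrow> real" where
  "egf_coeff F a b c = fact a * fact b * fact c * F $ a $ b $ c"

lemma egf_coeff_linear:
  "egf_coeff (F + G) a b c = egf_coeff F a b c + egf_coeff G a b c"
  "egf_coeff (F - G) a b c = egf_coeff F a b c - egf_coeff G a b c"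
  "egf_coeff (- F) a b c = - egf_coeff F a b c"
  "egf_coeff (2 * F) a b c = 2 * egf_coeff F a b c"
  using const3_mult_nth[of 2 F a b c]
  by (simp_all add: egf_coeff_def algebra_simps const3_numeral)

lemma egf_coeff_hs: "egf_coeff (hs * F) a b c = egf_coeff F a b c / sqrt 2"
  by (simp add: egf_coeff_def hs_def)

lemma egf_coeff_derivs:
  "egf_coeff (dX F) a b c = egf_coeff F (Suc a) b c"
  "egf_coeff (dY F) a b c = egf_coeff F a (Suc b) c"
  "egf_coeff (dZ F) a b c = egf_coeff F a b (Suc c)"
  by (simp_all add: egf_coeff_def dX_nth dY_nth dZ_nth mult_ac)

lemma egf_coeff_at_0:
  "egf_coeff (F * sX) 0 b c = 0"
  "egf_coeff (F * sY) a 0 c = 0"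
  "egf_coeff (F * sZ) a b 0 = 0"
  "egf_coeff (F * cY) a 0 c = egf_coeff F a 0 c"
  "egf_coeff (F * cZ) a b 0 = egf_coeff F a b 0"
  unfolding egf_coeff_def mult_sX_nth mult_sY_nth mult_sZ_nth mult_cY_nth_0 mult_cZ_nth_0 by simp_all

text \<open>\<open>E3\<close> is a series in \<open>x + y + z\<close>: its equal partial derivatives
  allow every unit of degree to move into the first index.\<close>

lemma egf_coeff_E3: "egf_coeff E3 a b c = egf_coeff E3 (a + b + c) 0 0"
proof -
  have Y: "egf_coeff E3 a (Suc b) c = egf_coeff E3 (Suc a) b c"
    and Z: "egf_coeff E3 a b (Suc c) = egf_coeff E3 (Suc a) b c" for a b c
    by (simp_all add: E3_derivs flip: egf_coeff_derivs)
  have "egf_coeff E3 a b c = egf_coeff E3 (a + c) b 0"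
    by (induction c arbitrary: a) (simp_all add: Z)
  also have "egf_coeff E3 a' b 0 = egf_coeff E3 (a' + b) 0 0" for a'
    by (induction b arbitrary: a') (simp_all add: Y)
  finally show ?thesis
    by (simp add: ac_simps)
qed

lemma E3_rotate: "E3 $ b $ c $ a = E3 $ a $ b $ c"
proof -
  have "egf_coeff E3 b c a = egf_coeff E3 a b c"
    using egf_coeff_E3[of a b c] egf_coeff_E3[of b c a] by (simp add: ac_simps)
  then have "(fact a * fact b * fact c) * E3 $ b $ c $ a = (fact a * fact b * fact c) * E3 $ a $ b $ c"
    by (simp add: egf_coeff_def mult_ac)
  then show ?thesis
    by simp
qed

text \<open>Telescoping leaves boundary values with second index 0, while the boundary conditions
  have third index 0; the symmetry of \<open>E3\<close> identifies them.\<close>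

lemma egf_coeff_E3_sin_rotate:
  "egf_coeff (E3 * sX) b 0 a = egf_coeff (E3 * sY) a b 0"
  "egf_coeff (E3 * sZ) b 0 a = egf_coeff (E3 * sX) a b 0"
  unfolding egf_coeff_def mult_sX_nth mult_sY_nth mult_sZ_nth
  by (simp_all add: E3_rotate[of _ 0 a] E3_rotate[of b 0])

section \<open>The recurrences in difference coordinates\<close>

text \<open>
  An entry of \<open>M\<^sub>n\<close> in row \<open>m\<close> and column \<open>k < m\<close> is addressed as \<open>A a b c\<close> with
  \<open>a = m - k - 1\<close>, \<open>b = k - 1\<close>, \<open>c = 2n - m\<close>; an entry above the diagonal as \<open>B a b c\<close> with the
  roles of \<open>m\<close> and \<open>k\<close> exchanged. Thus \<open>n\<close> is encoded in the degree \<open>a + b + c = 2n - 2\<close>, and the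
  totals at \<open>u\<close>, \<open>v\<close> are those of line \<open>u + 1\<close> of the matrix of size \<open>u + v + 1\<close>.
\<close>
definition row_total :: "(nat \<Rightarrow> nat \<Rightarrow> nat \<Rightarrow> real) \<Rightarrow> (nat \<Rightarrow> nat \<Rightarrow> nat \<Rightarrow> real) \<Rightarrow> nat \<Rightarrow> nat \<Rightarrow> real" where
  "row_total A B u v = (\<Sum>j<u. A (u - Suc j) j v) + (\<Sum>i<v. B i u (v - Suc i))"

definition col_total :: "(nat \<Rightarrow> nat \<Rightarrow> nat \<Rightarrow> real) \<Rightarrow> (nat \<Rightarrow> nat \<Rightarrow> nat \<Rightarrow> real) \<Rightarrow> nat \<Rightarrow> nat \<Rightarrow> real" where
  "col_total A B u v = (\<Sum>i<v. A i u (v - Suc i)) + (\<Sum>j<u. B (u - Suc j) j v)"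

text \<open>The indices \<open>c = 0\<close> and \<open>c = Suc 0\<close> are the last two rows for
  \<open>A\<close> and the last two columns for \<open>B\<close>. In the recurrences, the term of
  degree two lower comes from the preceding matrix.\<close>

definition delta_system :: "(nat \<Rightarrow> nat \<Rightarrow> nat \<Rightarrow> real) \<Rightarrow> (nat \<Rightarrow> nat \<Rightarrow> nat \<Rightarrow> real) \<Rightarrow> bool" where
  "delta_system A B \<longleftrightarrow>
    A 0 0 0 = 1 \<and> (\<forall>b. A 0 (Suc b) 0 = 0) \<and>
    (\<forall>a b. A (Suc a) b 0 = row_total A B b a) \<and>
    (\<forall>a b. A a b (Suc 0) = row_total A B b a + col_total A B b a) \<and>
    (\<forall>a b c. A (a + 2) b c - 2 * A (a + 1) b (c + 1) + A a b (c + 2) + 2 * A a b c = 0) \<and>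
    (\<forall>a b. B a b 0 = 0) \<and>
    (\<forall>a b. B a b (Suc 0) = row_total A B b a) \<and>
    (\<forall>a b c. B (a + 2) b c - 2 * B (a + 1) b (c + 1) + B a b (c + 2) + 2 * B a b c = 0)"

lemma delta_system_wave:
  assumes "delta_system A B"
  shows "A (a + 2) b c - 2 * A (a + 1) b (c + 1) + A a b (c + 2) + 2 * A a b c = 0"
    and "B (a + 2) b c - 2 * B (a + 1) b (c + 1) + B a b (c + 2) + 2 * B a b c = 0"
  using assms by (simp_all only: delta_system_def)

text \<open>Outer induction on the total degree, inner induction on the third index \<open>k\<close>
  with \<open>b\<close> and \<open>i + k\<close> fixed. The totals and the last recurrence term have
  degree two lower; the recurrence then reaches \<open>k + 2\<close> from \<open>k\<close> and
  \<open>k + 1\<close>.\<close>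

lemma delta_system_unique:
  assumes "delta_system A B" "delta_system A' B'"
  shows "A a b c = A' a b c \<and> B a b c = B' a b c"
proof (induction "a + b + c" arbitrary: a b c rule: less_induct)
  case less
  have row: "row_total A B u v = row_total A' B' u v"
    and col: "col_total A B u v = col_total A' B' u v" if "u + v < a + b + c" for u v
    unfolding row_total_def col_total_def using that less
    by (auto intro!: arg_cong2[of _ _ _ _ "(+)"] sum.cong)
  have "A i b k = A' i b k \<and> B i b k = B' i b k" if "i + k = a + c" for i k
    using that
  proof (induction k arbitrary: i rule: less_induct)
    case (less k)
    consider "k = 0" "i = 0" "b = 0" | b' where "k = 0" "i = 0" "b = Suc b'"
      | i' where "k = 0" "i = Suc i'" | "k = 1" | k' where "k = k' + 2"
      by (cases k; cases "k - 1"; cases i; cases b) auto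
    then show ?case
    proof cases
      case 3
      then have "row_total A B b i' = row_total A' B' b i'"
        using row[of b i'] less.prems by simp
      then show ?thesis
        using assms unfolding 3 by (simp add: delta_system_def)
    next
      case 5
      have "A (i + 1) b (k' + 1) = A' (i + 1) b (k' + 1)" "B (i + 1) b (k' + 1) = B' (i + 1) b (k' + 1)"
        "A (i + 2) b k' = A' (i + 2) b k'" "B (i + 2) b k' = B' (i + 2) b k'"
        using less.IH[of "k' + 1" "i + 1"] less.IH[of k' "i + 2"] less.prems 5 by simp_all
      moreover have "A i b k' = A' i b k'" "B i b k' = B' i b k'"
        using \<open>\<And>a' b' c'. a' + b' + c' < a + b + c \<Longrightarrow> A a' b' c' = A' a' b' c' \<and> B a' b' c' = B' a' b' c'\<close>[of i b k']
          less.prems 5 by simp_all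
      moreover have "A (i + 2) b k' - 2 * A (i + 1) b (k' + 1) + A i b (k' + 2) + 2 * A i b k' = 0"
        "A' (i + 2) b k' - 2 * A' (i + 1) b (k' + 1) + A' i b (k' + 2) + 2 * A' i b k' = 0"
        "B (i + 2) b k' - 2 * B (i + 1) b (k' + 1) + B i b (k' + 2) + 2 * B i b k' = 0"
        "B' (i + 2) b k' - 2 * B' (i + 1) b (k' + 1) + B' i b (k' + 2) + 2 * B' i b k' = 0"
        by (rule assms[THEN delta_system_wave(1)] assms[THEN delta_system_wave(2)])+
      ultimately show ?thesis
        unfolding 5 by linarith
    qed (use assms row[of b i] col[of b i] less.prems in \<open>auto simp: delta_system_def\<close>)
  qed
  then show ?case by simp
qed

section \<open>Telescoping of row and column totals\<close>

lemma row_total_telescope: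
  assumes A: "\<And>a b c. A a b c = P (Suc a) b c - P a (Suc b) c"
    and B: "\<And>a b c. B a b c = Q (Suc a) b c - Q a b (Suc c)"
  shows "row_total A B u v = P u 0 v - P 0 u v + (Q v u 0 - Q 0 u v)"
proof -
  \<comment> \<open>Left of the diagonal \<open>a + b\<close> is constant along a row, right of it
    \<open>a + c\<close>; hence the different index pairs in \<open>P\<close> and
    \<open>Q\<close>.\<close>
  have "(\<Sum>j<u. A (u - Suc j) j v) = (\<Sum>j<u. P (u - j) j v - P (u - Suc j) (Suc j) v)"
    by (intro sum.cong refl) (simp add: A Suc_diff_Suc)
  also have "\<dots> = P u 0 v - P 0 u v"
    using sum_lessThan_telescope'[of "\<lambda>j. P (u - j) j v" u] by simp
  finally have 1: "(\<Sum>j<u. A (u - Suc j) j v) = P u 0 v - P 0 u v" .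
  have "(\<Sum>i<v. B i u (v - Suc i)) = (\<Sum>i<v. Q (Suc i) u (v - Suc i) - Q i u (v - i))"
    by (intro sum.cong refl) (simp add: B Suc_diff_Suc)
  also have "\<dots> = Q v u 0 - Q 0 u v"
    using sum_lessThan_telescope[of "\<lambda>i. Q i u (v - i)" v] by simp
  finally show ?thesis
    by (simp add: row_total_def 1)
qed

text \<open>Transposition: column totals are row totals with the two arrays exchanged.\<close>

lemma col_total_telescope:
  assumes A: "\<And>a b c. A a b c = P (Suc a) b c - P a b (Suc c)"
    and B: "\<And>a b c. B a b c = Q (Suc a) b c - Q a (Suc b) c"
  shows "col_total A B u v = P v u 0 - P 0 u v + (Q u 0 v - Q 0 u v)"
  using row_total_telescope[of B Q A P u v] assms
  by (simp add: row_total_def col_total_def)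

section \<open>The closed forms solve the system\<close>

lemma egf_coeff_GL_GU_eqs:
  "egf_coeff GL a b c =
    egf_coeff (hs * (E3 * sX - E3 * sY * cZ)) (Suc a) b c - egf_coeff (hs * (E3 * sX - E3 * sY * cZ)) a (Suc b) c"
  "egf_coeff GL a b c =
    egf_coeff (hs * (E3 * sX - E3 * cY * sZ)) (Suc a) b c - egf_coeff (hs * (E3 * sX - E3 * cY * sZ)) a b (Suc c)"
  "egf_coeff GU a b c = egf_coeff (hs * (E3 * sY * cZ)) (Suc a) b c - egf_coeff (hs * (E3 * sY * cZ)) a b (Suc c)"
  "egf_coeff GU a b c = egf_coeff (hs * (E3 * cY * sZ)) (Suc a) b c - egf_coeff (hs * (E3 * cY * sZ)) a (Suc b) c"
  unfolding egf_coeff_derivs[symmetric] egf_coeff_linear(2)[symmetric]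
    GL_antideriv_XY GL_antideriv_XZ GU_antideriv_XZ GU_antideriv_XY by simp_all

lemma delta_system_egf_coeff: "delta_system (egf_coeff GL) (egf_coeff GU)"
proof -
  let ?sX = "\<lambda>a b. egf_coeff (E3 * sX) a b 0 * 2 / sqrt 2"
  let ?sY = "\<lambda>a b. egf_coeff (E3 * sY) a b 0 * 2 / sqrt 2"
  have cancel_sZ: "egf_coeff (E3 * cY * sZ) a 0 c = egf_coeff (E3 * sZ) a 0 c" for a c
    using egf_coeff_at_0(4)[of "E3 * sZ"] by (simp add: mult_ac)
  have cancel_sY: "egf_coeff (E3 * sY * cZ) a 0 c = 0" for a c
    using egf_coeff_at_0(2)[of "E3 * cZ"] by (simp add: mult_ac)
  \<comment> \<open>The boundary terms with first index 0 cancel. The two that remain agree by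
    rotation, hence the factor 2 in \<open>?sY\<close>, and likewise in \<open>?sX\<close> for
    columns.\<close>
  have row: "row_total (egf_coeff GL) (egf_coeff GU) b a = ?sY a b" for a b
    by (subst row_total_telescope[where P = "egf_coeff (hs * (E3 * sX - E3 * sY * cZ))"
            and Q = "egf_coeff (hs * (E3 * sY * cZ))", OF egf_coeff_GL_GU_eqs(1) egf_coeff_GL_GU_eqs(3)])
      (simp add: egf_coeff_hs egf_coeff_linear egf_coeff_at_0 cancel_sY egf_coeff_E3_sin_rotate)
  have col: "col_total (egf_coeff GL) (egf_coeff GU) b a = ?sX a b" for a b
    by (subst col_total_telescope[where P = "egf_coeff (hs * (E3 * sX - E3 * cY * sZ))"
            and Q = "egf_coeff (hs * (E3 * cY * sZ))", OF egf_coeff_GL_GU_eqs(2) egf_coeff_GL_GU_eqs(4)])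
      (simp add: egf_coeff_hs egf_coeff_linear egf_coeff_at_0 cancel_sZ egf_coeff_E3_sin_rotate)
  have GL_X: "egf_coeff GL (Suc a) b 0 = ?sY a b" for a b
    unfolding egf_coeff_derivs[symmetric] dX_GL
    by (simp add: egf_coeff_hs egf_coeff_linear egf_coeff_at_0 mult.assoc[of 2 hs])
  have GL_Z: "egf_coeff GL a b (Suc 0) = ?sY a b + ?sX a b" for a b
    unfolding egf_coeff_derivs(3)[symmetric] dZ_GL
    by (simp add: egf_coeff_hs egf_coeff_linear egf_coeff_at_0 mult.assoc[of 2 hs] egf_coeff_derivs GL_X)
  \<comment> \<open>At first index 0 the \<open>sX\<close> term of \<open>dY_GL\<close> vanishes and
    the other two cancel.\<close>
  have GL_Y: "egf_coeff GL 0 (Suc b) 0 = 0" for b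
    unfolding egf_coeff_derivs(2)[symmetric] dY_GL
    by (simp add: egf_coeff_hs egf_coeff_linear egf_coeff_at_0 mult.assoc[of 2 hs] egf_coeff_derivs GL_X)
  have GU_Z: "egf_coeff GU a b (Suc 0) = ?sY a b" for a b
    unfolding egf_coeff_derivs(3)[symmetric] dZ_GU
    by (simp add: egf_coeff_hs egf_coeff_linear egf_coeff_at_0 mult.assoc[of 2 hs])
  have GU_0: "egf_coeff GU a b 0 = 0" for a b
    by (simp add: GU_def egf_coeff_at_0)
  have E0: "E3 $ 0 $ 0 $ 0 = 1 / 2"
    using arg_cong[OF E3_mult, of "\<lambda>F. F $ 0 $ 0 $ 0"] by simp
  have GL_0: "egf_coeff GL 0 0 0 = 1"
    by (simp add: GL_def egf_coeff_def E0)
  have wave: "egf_coeff F (a + 2) b c - 2 * egf_coeff F (a + 1) b (c + 1) + egf_coeff F a b (c + 2)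
      + 2 * egf_coeff F a b c = 0"
    if "dX (dX F - dZ F) - dZ (dX F - dZ F) = - (2 * F)" for F a b c
    using arg_cong[OF that, of "\<lambda>F. egf_coeff F a b c"]
    by (simp add: egf_coeff_linear egf_coeff_derivs)
  show ?thesis
    unfolding delta_system_def
    by (simp only: row col GL_X GL_Y GL_Z GU_Z GU_0 GL_0 wave[OF GL_wave] wave[OF GU_wave] simp_thms)
qed

section \<open>The Delta sequence\<close>

text \<open>Only the even degrees \<open>2n - 2\<close> belong to a matrix; the default 0 in odd
  degrees lets the system hold in every degree.\<close>

definition lower_array :: "(nat \<Rightarrow> nat \<Rightarrow> nat \<Rightarrow> nat) \<Rightarrow> nat \<Rightarrow> nat \<Rightarrow> nat \<Rightarrow> real" where
  "lower_array f a b c =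
    (if even (a + b + c) then real (f (Suc ((a + b + c) div 2)) (a + b + 2) (b + 1)) else 0)"

definition upper_array :: "(nat \<Rightarrow> nat \<Rightarrow> nat \<Rightarrow> nat) \<Rightarrow> nat \<Rightarrow> nat \<Rightarrow> nat \<Rightarrow> real" where
  "upper_array f a b c =
    (if even (a + b + c) then real (f (Suc ((a + b + c) div 2)) (b + 1) (a + b + 2)) else 0)"

lemma array_eq:
  assumes "a + b + c + 2 = 2 * n"
  shows "lower_array f a b c = real (f n (a + b + 2) (b + 1))"
    and "upper_array f a b c = real (f n (b + 1) (a + b + 2))"
proof -
  have *: "even (a + b + c + 2)" "(a + b + c + 2) div 2 = n"
    unfolding assms by simp_all
  then have "even (a + b + c)" "Suc ((a + b + c) div 2) = n"
    by simp_all
  then show "lower_array f a b c = real (f n (a + b + 2) (b + 1))"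
    and "upper_array f a b c = real (f n (b + 1) (a + b + 2))"
    by (simp_all add: lower_array_def upper_array_def)
qed

text \<open>Used to cut a row or column of length \<open>u + 1 + v\<close> at its diagonal
  entry.\<close>

lemma sum_split_at: "(\<Sum>k = 1..u + 1 + v. g k) = (\<Sum>j<u. g (j + 1)) + g (u + 1) + (\<Sum>i<v. g (i + u + 2))"
  for g :: "nat \<Rightarrow> 'a :: comm_monoid_add"
proof (induction v)
  case 0
  show ?case
    by (induction u) simp_all
next
  case (Suc v)
  then show ?case
    by (simp add: ac_simps)
qed

text \<open>All summands have degree \<open>u + v - 1\<close>, which is odd here.\<close>

lemma totals_even:
  assumes "even (u + v)"
  shows "row_total (lower_array f) (upper_array f) u v = 0"
    and "col_total (lower_array f) (upper_array f) u v = 0"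
proof -
  have "odd (u - Suc j + j + v)" if "j < u" for j
    using that assms by presburger
  moreover have "odd (i + u + (v - Suc i))" if "i < v" for i
    using that assms by presburger
  ultimately show "row_total (lower_array f) (upper_array f) u v = 0"
    and "col_total (lower_array f) (upper_array f) u v = 0"
    by (simp_all add: row_total_def col_total_def lower_array_def upper_array_def)
qed

context
  fixes f :: "nat \<Rightarrow> nat \<Rightarrow> nat \<Rightarrow> nat"
  assumes delta: "delta_sequence f"
begin

lemma delta_diag: "1 \<le> n \<Longrightarrow> 1 \<le> m \<Longrightarrow> m \<le> 2 * n \<Longrightarrow> f n m m = 0"
proof (cases "n = 1")
  case True
  assume "1 \<le> m" "m \<le> 2 * n"
  with True have "m = 1 \<or> m = 2" by auto
  with True delta show ?thesis
    by (auto simp: delta_sequence_def numeral_2_eq_2)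
qed (use delta in \<open>auto simp: delta_sequence_def\<close>)

text \<open>The conditions at \<open>n = Suc p\<close>, so that the indices contain no subtraction
  of naturals.\<close>

lemma delta_rules:
  assumes "1 \<le> p"
  shows delta_lower: "1 \<le> k \<Longrightarrow> k + 1 \<le> m \<Longrightarrow> m \<le> 2 * p \<Longrightarrow>
      real (f (Suc p) (m + 2) k) - 2 * real (f (Suc p) (m + 1) k) + real (f (Suc p) m k) + 2 * real (f p m k) = 0"
    and delta_upper: "1 \<le> m \<Longrightarrow> m + 1 \<le> k \<Longrightarrow> k \<le> 2 * p \<Longrightarrow>
      real (f (Suc p) m (k + 2)) - 2 * real (f (Suc p) m (k + 1)) + real (f (Suc p) m k) + 2 * real (f p m k) = 0"
    and delta_last_col: "1 \<le> m \<Longrightarrow> m \<le> 2 * p + 2 \<Longrightarrow> f (Suc p) m (2 * p + 2) = 0"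
    and delta_corner: "f (Suc p) (2 * p + 2) (2 * p + 1) = 0"
    and delta_penultimate_col: "1 \<le> m \<Longrightarrow> m \<le> 2 * p \<Longrightarrow> f (Suc p) m (2 * p + 1) = row_sum f p m"
    and delta_last_row: "1 \<le> m \<Longrightarrow> m \<le> 2 * p \<Longrightarrow> f (Suc p) (2 * p + 2) m = row_sum f p m"
    and delta_penultimate_row: "1 \<le> m \<Longrightarrow> m \<le> 2 * p \<Longrightarrow>
      f (Suc p) (2 * p + 1) m = row_sum f p m + col_sum f p m"
proof -
  have n: "2 \<le> Suc p" "2 * Suc p = 2 * p + 2" "2 * p + 2 - 1 = 2 * p + 1" "2 * p + 2 - 2 = 2 * p"
    "Suc p - 1 = p"
    using assms by simp_all
  note step = delta[unfolded delta_sequence_def, THEN conjunct2, THEN conjunct2, THEN conjunct2,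
      THEN conjunct2, THEN conjunct2, rule_format (no_asm), OF n(1), unfolded n L1_def U1_def]
  have cast: "int q - 2 * int r + int s + 2 * int t = 0 \<Longrightarrow> real q - 2 * real r + real s + 2 * real t = 0"
    for q r s t by linarith
  have "int (f (Suc p) (m + 2) k) - 2 * int (f (Suc p) (m + 1) k) + int (f (Suc p) m k) + 2 * int (f p m k) = 0"
    if "1 \<le> k" "k + 1 \<le> m" "m \<le> 2 * p" for m k
    using step that by auto
  then show "1 \<le> k \<Longrightarrow> k + 1 \<le> m \<Longrightarrow> m \<le> 2 * p \<Longrightarrow>
      real (f (Suc p) (m + 2) k) - 2 * real (f (Suc p) (m + 1) k) + real (f (Suc p) m k) + 2 * real (f p m k) = 0"
    by (blast intro: cast)
  have "int (f (Suc p) m (k + 2)) - 2 * int (f (Suc p) m (k + 1)) + int (f (Suc p) m k) + 2 * int (f p m k) = 0"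
    if "1 \<le> m" "m + 1 \<le> k" "k \<le> 2 * p" for m k
    using step that by auto
  then show "1 \<le> m \<Longrightarrow> m + 1 \<le> k \<Longrightarrow> k \<le> 2 * p \<Longrightarrow>
      real (f (Suc p) m (k + 2)) - 2 * real (f (Suc p) m (k + 1)) + real (f (Suc p) m k) + 2 * real (f p m k) = 0"
    by (blast intro: cast)
qed (use delta[unfolded delta_sequence_def, THEN conjunct2, THEN conjunct2, THEN conjunct2,
      THEN conjunct2, THEN conjunct2, rule_format (no_asm), of "Suc p"] assms in simp_all)

text \<open>The totals skip the diagonal entry, which is zero; their summands have degree
  \<open>u + v - 1 = 2n - 2\<close>, that of the matrix with index \<open>n\<close>.\<close>

lemma totals_odd:
  assumes n: "u + v + 1 = 2 * n"
  shows "row_total (lower_array f) (upper_array f) u v = real (row_sum f n (u + 1))"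
    and "col_total (lower_array f) (upper_array f) u v = real (col_sum f n (u + 1))"
proof -
  have diag: "f n (u + 1) (u + 1) = 0"
    using n by (intro delta_diag) auto
  have len: "2 * n = u + 1 + v"
    using n by simp
  have arrays: "lower_array f (u - Suc j) j v = real (f n (u + 1) (j + 1))"
    "upper_array f (u - Suc j) j v = real (f n (j + 1) (u + 1))" if "j < u" for j
    using array_eq[of "u - Suc j" j v n f] that n by (auto simp: less_iff_Suc_add)
  have arrays': "lower_array f i u (v - Suc i) = real (f n (i + u + 2) (u + 1))"
    "upper_array f i u (v - Suc i) = real (f n (u + 1) (i + u + 2))" if "i < v" for i
    using array_eq[of i u "v - Suc i" n f] that n by auto
  show "row_total (lower_array f) (upper_array f) u v = real (row_sum f n (u + 1))"
    unfolding row_total_def row_sum_def len sum_split_at diag by (simp add: arrays arrays')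
  show "col_total (lower_array f) (upper_array f) u v = real (col_sum f n (u + 1))"
    unfolding col_total_def col_sum_def len sum_split_at diag by (simp add: arrays arrays')
qed

lemma delta_system_arrays: "delta_system (lower_array f) (upper_array f)"
  unfolding delta_system_def
proof (intro conjI allI)
  let ?A = "lower_array f" and ?B = "upper_array f"
  show "?A 0 0 0 = 1"
    using delta by (simp add: lower_array_def delta_sequence_def numeral_2_eq_2)
  show "?A 0 (Suc b) 0 = 0" for b
  proof (cases "even (Suc b)")
    case True
    then obtain p where p: "Suc b = 2 * p" by blast
    then show ?thesis
      using array_eq(1)[of 0 "Suc b" 0 "Suc p" f] delta_corner[of p] by simp
  qed (simp add: lower_array_def)
  show "?A (Suc a) b 0 = row_total ?A ?B b a" for a b
  proof (cases "even (a + b)")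
    case True
    then show ?thesis
      using totals_even[of b a] by (simp add: lower_array_def add.commute)
  next
    case False
    then have "even (a + b + 1)" by simp
    then obtain p where p: "a + b + 1 = 2 * p" by blast
    \<comment> \<open>Degree \<open>2 * p\<close> places this entry in matrix \<open>Suc p\<close>,
      while the total on the other side belongs to matrix \<open>p\<close>.\<close>
    then have "?A (Suc a) b 0 = real (f (Suc p) (2 * p + 2) (b + 1))"
      using array_eq(1)[of "Suc a" b 0 "Suc p" f] by (simp flip: p)
    then show ?thesis
      using p delta_last_row[of p "b + 1"] by (simp add: totals_odd(1)[of b a p])
  qed
  show "?A a b (Suc 0) = row_total ?A ?B b a + col_total ?A ?B b a" for a b
  proof (cases "even (a + b)")
    case True
    then show ?thesis
      using totals_even[of b a] by (simp add: lower_array_def add.commute)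
  next
    case False
    then have "even (a + b + 1)" by simp
    then obtain p where p: "a + b + 1 = 2 * p" by blast
    then have "?A a b (Suc 0) = real (f (Suc p) (2 * p + 1) (b + 1))"
      using array_eq(1)[of a b "Suc 0" "Suc p" f] by (simp flip: p)
    then show ?thesis
      using p delta_penultimate_row[of p "b + 1"] by (simp add: totals_odd[of b a p])
  qed
  show "?B a b (Suc 0) = row_total ?A ?B b a" for a b
  proof (cases "even (a + b)")
    case True
    then show ?thesis
      using totals_even[of b a] by (simp add: upper_array_def add.commute)
  next
    case False
    then have "even (a + b + 1)" by simp
    then obtain p where p: "a + b + 1 = 2 * p" by blast
    then have "?B a b (Suc 0) = real (f (Suc p) (b + 1) (2 * p + 1))"
      using array_eq(2)[of a b "Suc 0" "Suc p" f] by (simp flip: p)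
    then show ?thesis
      using p delta_penultimate_col[of p "b + 1"] by (simp add: totals_odd(1)[of b a p])
  qed
  show "?B a b 0 = 0" for a b
  proof (cases "even (a + b)")
    case True
    then obtain p where p: "a + b = 2 * p" by blast
    have "?B a b 0 = real (f (Suc p) (b + 1) (2 * p + 2))"
      using array_eq(2)[of a b 0 "Suc p" f] by (simp flip: p)
    also have "f (Suc p) (b + 1) (2 * p + 2) = 0"
    \<comment> \<open>The case \<open>p = 0\<close> is the first matrix, whose entries are given
      explicitly.\<close>
    proof (cases "p = 0")
      case True
      with p delta show ?thesis
        by (simp add: delta_sequence_def numeral_2_eq_2)
    next
      case False
      with p show ?thesis
        using delta_last_col[of p "b + 1"] by simp
    qed
    finally show ?thesis by simp
  qed (simp add: upper_array_def)
  show "?A (a + 2) b c - 2 * ?A (a + 1) b (c + 1) + ?A a b (c + 2) + 2 * ?A a b c = 0"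
    "?B (a + 2) b c - 2 * ?B (a + 1) b (c + 1) + ?B a b (c + 2) + 2 * ?B a b c = 0" for a b c
  proof -
    have *: "?A (a + 2) b c - 2 * ?A (a + 1) b (c + 1) + ?A a b (c + 2) + 2 * ?A a b c = 0 \<and>
      ?B (a + 2) b c - 2 * ?B (a + 1) b (c + 1) + ?B a b (c + 2) + 2 * ?B a b c = 0"
    proof (cases "even (a + b + c)")
      case True
      then have "even (a + b + c + 2)" by simp
      then obtain p where p: "a + b + c + 2 = 2 * p" by blast
      \<comment> \<open>The entries at \<open>a b c\<close> lie in matrix \<open>p\<close>, all the
        others in matrix \<open>Suc p\<close>.\<close>
      show ?thesis
        using array_eq[of "a + 2" b c "Suc p" f] array_eq[of "a + 1" b "c + 1" "Suc p" f]
          array_eq[of a b "c + 2" "Suc p" f] array_eq[of a b c p f] p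
          delta_lower[of p "b + 1" "a + b + 2"] delta_upper[of p "b + 1" "a + b + 2"]
        by (simp add: ac_simps)
    next
      case False
      then show ?thesis
        by (simp add: lower_array_def upper_array_def)
    qed
    from * show "?A (a + 2) b c - 2 * ?A (a + 1) b (c + 1) + ?A a b (c + 2) + 2 * ?A a b c = 0"
      "?B (a + 2) b c - 2 * ?B (a + 1) b (c + 1) + ?B a b (c + 2) + 2 * ?B a b c = 0"
      by blast+
  qed
qed

end

section \<open>Coefficients of the series in the theorem\<close>

lemma monomial_nth:
  "(const3 r * (const3 p * X3 ^ i) * (const3 q * Y3 ^ j) * (const3 s * Z3 ^ l)) $ a $ b $ c =
    (if a = i \<and> b = j \<and> c = l then r * p * q * s else 0)"
proof -
  have X: "(X3 ^ i * F) $ a $ b $ c = (if a < i then 0 else F $ (a - i) $ b $ c)" for F a b c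
    by (simp add: X3_def fps_X_power_mult_nth)
  have Y: "(Y3 ^ j * F) $ a $ b $ c = (if b < j then 0 else F $ a $ (b - j) $ c)" for F a b c
  proof -
    have "Y3 ^ j = fps_const (fps_X ^ j)"
      by (induction j) (simp_all add: Y3_def)
    then show ?thesis
      by (simp add: fps_X_power_mult_nth)
  qed
  have eq: "const3 r * (const3 p * X3 ^ i) * (const3 q * Y3 ^ j) * (const3 s * Z3 ^ l)
    = const3 (r * p * q * s) * (X3 ^ i * (Y3 ^ j * Z3 ^ l))"
    by (simp add: const3_mult mult_ac)
  show ?thesis
    unfolding eq const3_mult_nth X Y Z3_power_nth by auto
qed

lemma finite_lower_index_set: "finite {(m, k). 2 \<le> k + 1 \<and> k + 1 \<le> m \<and> m \<le> 2 * (n :: nat)}"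
  by (rule finite_subset[of _ "{..2 * n} \<times> {..2 * n}"]) auto

text \<open>A monomial determines \<open>m\<close>, \<open>k\<close> and \<open>n\<close> from its
  exponents, so at most one summand contributes.\<close>

lemma lower_sum_nth:
  "(\<Sum>(m, k)\<in>{(m, k). 2 \<le> k + 1 \<and> k + 1 \<le> m \<and> m \<le> 2 * n}.
      const3 (real (f n m k))
        * (const3 (1 / fact (m - k - 1)) * X3 ^ (m - k - 1))
        * (const3 (1 / fact (k - 1)) * Y3 ^ (k - 1))
        * (const3 (1 / fact (2 * n - m)) * Z3 ^ (2 * n - m))) $ a $ b $ c =
    (if a + b + c + 2 = 2 * n then real (f n (a + b + 2) (b + 1)) / (fact a * fact b * fact c) else 0)"
  (is "(\<Sum>(m, k)\<in>?S. ?t m k) $ a $ b $ c = ?rhs")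
proof -
  have "(\<Sum>(m, k)\<in>?S. ?t m k) $ a $ b $ c = (\<Sum>mk\<in>?S. ?t (fst mk) (snd mk) $ a $ b $ c)"
    by (simp only: fps_sum_nth case_prod_beta)
  also have "\<dots> = (\<Sum>mk\<in>?S. if mk = (a + b + 2, b + 1) then ?rhs else 0)"
  proof (rule sum.cong[OF refl])
    fix mk assume "mk \<in> ?S"
    then obtain m k where mk: "mk = (m, k)" "1 \<le> k" "k + 1 \<le> m" "m \<le> 2 * n"
      by auto
    have "a = m - k - 1 \<and> b = k - 1 \<and> c = 2 * n - m \<longleftrightarrow>
      m = a + b + 2 \<and> k = b + 1 \<and> a + b + c + 2 = 2 * n"
      using mk by auto
    then show "?t (fst mk) (snd mk) $ a $ b $ c = (if mk = (a + b + 2, b + 1) then ?rhs else 0)"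
      unfolding monomial_nth mk(1) fst_conv snd_conv by auto
  qed
  \<comment> \<open>If the pair \<open>(a + b + 2, b + 1)\<close> is outside the index set, then
    \<open>a + b + 2 > 2 * n\<close> and \<open>?rhs\<close> is 0 as well.\<close>
  also have "\<dots> = ?rhs"
    using finite_lower_index_set[of n] by (simp add: sum.delta)
  finally show ?thesis .
qed

text \<open>Quotient and product with \<open>E3\<close> agree after multiplication by the
  denominator, a nonzero series that can be cancelled.\<close>

lemma closed_form_eq_GL:
  "(cos3 (const3 (sqrt 2) * X3) + cos3 (const3 (sqrt 2) * Y3) * cos3 (const3 (sqrt 2) * Z3))
      / (2 * (cos3 (const3 (1 / sqrt 2) * (X3 + Y3 + Z3)))\<^sup>2) = GL"
proof -
  have D: "(2 * cW\<^sup>2) $ 0 $ 0 $ 0 \<noteq> 0"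
    using cos3_denominator_nth_0 by (simp add: cW_def)
  have "(cX + cY * cZ) / (2 * cW\<^sup>2) * (2 * cW\<^sup>2) = GL * (2 * cW\<^sup>2)"
    unfolding fps3_divide_mult[OF D] GL_def using E3_mult by algebra
  moreover have "2 * cW\<^sup>2 \<noteq> 0"
    using D by auto
  ultimately have "(cX + cY * cZ) / (2 * cW\<^sup>2) = GL"
    by (metis mult_right_cancel)
  then show ?thesis
    by (simp only: cX_def cY_def cZ_def cW_def)
qed

theorem theorem1p3:
  fixes f :: "nat \<Rightarrow> nat \<Rightarrow> nat \<Rightarrow> nat"
  assumes "delta_sequence f"
  shows "has_sum3
    (\<lambda>n. \<Sum>(m, k)\<in>{(m, k). 2 \<le> k + 1 \<and> k + 1 \<le> m \<and> m \<le> 2 * n}.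
      const3 (real (f n m k))
        * (const3 (1 / fact (m - k - 1)) * X3 ^ (m - k - 1))
        * (const3 (1 / fact (k - 1)) * Y3 ^ (k - 1))
        * (const3 (1 / fact (2 * n - m)) * Z3 ^ (2 * n - m)))
    {1..}
    ((cos3 (const3 (sqrt 2) * X3) + cos3 (const3 (sqrt 2) * Y3) * cos3 (const3 (sqrt 2) * Z3))
      / (2 * (cos3 (const3 (1 / sqrt 2) * (X3 + Y3 + Z3)))\<^sup>2))"
  unfolding has_sum3_def lower_sum_nth closed_form_eq_GL
proof (intro allI conjI)
  fix a b c
  let ?g = "\<lambda>n. if a + b + c + 2 = 2 * n then real (f n (a + b + 2) (b + 1)) / (fact a * fact b * fact c) else 0"
  let ?N = "Suc ((a + b + c) div 2)"
  have supp: "{n \<in> {1..}. ?g n \<noteq> 0} \<subseteq> {?N}"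
    by (auto split: if_splits)
  then show "finite {n \<in> {1..}. ?g n \<noteq> 0}"
    by (rule finite_subset) simp
  \<comment> \<open>In odd degree the support is empty, and the added term at \<open>?N\<close> is
    0, matching the default of \<open>lower_array\<close>.\<close>
  have "(\<Sum>n | n \<in> {1..} \<and> ?g n \<noteq> 0. ?g n) = (\<Sum>n\<in>{?N}. ?g n)"
    using supp by (intro sum.mono_neutral_left) auto
  also have "\<dots> = lower_array f a b c / (fact a * fact b * fact c)"
  proof -
    have "a + b + c + 2 = 2 * ?N \<longleftrightarrow> even (a + b + c)"
      by presburger
    then show ?thesis
      by (simp add: lower_array_def)
  qed
  also have "\<dots> = egf_coeff GL a b c / (fact a * fact b * fact c)"
    using delta_system_unique[OF delta_system_arrays[OF assms] delta_system_egf_coeff] by simp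
  also have "\<dots> = GL $ a $ b $ c"
    by (simp add: egf_coeff_def)
  finally show "(\<Sum>n | n \<in> {1..} \<and> ?g n \<noteq> 0. ?g n) = GL $ a $ b $ c" .
qed

end
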